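(* Let $a,b\in\mathbb{R}$ with $0<a<b$. For all $q\ge 1$ and $p$ with $\frac1p+\frac1q=1$, put $$S=\sum_{i=1}^{2}\left[\left(\frac{q+3}{q+1}\right)^{i-1}\frac1{b^{3q}}+\left(\frac{q+3}{q+1}\right)^{2-i}\frac1{a^{3q}}\right]^{\frac1q}.$$ Then $$\left|A^{-1}(a,b)-L^{-1}(a,b)\right|\le\frac{(b-a)^2}{8}\left(\frac1{p+1}\right)^{\frac1p}\left(\frac1{2(q+2)}\right)^{\frac1q}S,$$ $$\left|H^{-1}(a,b)-L^{-1}(a,b)\right|\le\frac{(b-a)^2}{8}\left(\frac{2^{p+1}-1}{p+1}\right)^{\frac1p}\left(\frac1{2(q+2)}\right)^{\frac1q}S,$$ and $$\left|\tfrac13H^{-1}(a,b)+\tfrac23A^{-1}(a,b)-L^{-1}(a,b)\right|\le\frac{(b-a)^2}{24}\left(\frac{2^{p+1}-1}{3(p+1)}\right)^{\frac1p}\left(\frac1{2(q+2)}\right)^{\frac1q}S.$$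
   Context: For $0<a<b$: $A(a,b)=\frac{a+b}{2}$ (arithmetic mean), $H(a,b)=\frac{2ab}{a+b}$ (harmonic mean), $L(a,b)=\frac{b-a}{\ln b-\ln a}$ (logarithmic mean). $M^{-1}(a,b)$ denotes $1/M(a,b)$ for a mean $M$. *)

theory Defs
  imports "HOL-Library.Extended_Real" "HOL-Real_Asymp.Real_Asymp"
begin

definition arith_mean :: "real \<Rightarrow> real \<Rightarrow> real" where
  "arith_mean a b = (a + b) / 2"

definition harm_mean :: "real \<Rightarrow> real \<Rightarrow> real" where
  "harm_mean a b = 2 * a * b / (a + b)"

definition log_mean :: "real \<Rightarrow> real \<Rightarrow> real" where
  "log_mean a b = (b - a) / (ln b - ln a)"

text \<open>
  The expression \<open>g(p)\<^sup>1\<^sup>/\<^sup>p\<close> for an exponent \<open>p\<close> that may be infinite, as it is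
  when \<open>p\<close> is conjugate to \<open>1\<close>.  The value at infinity is the limit as \<open>p\<close> tends to
  infinity; the lemmas below show that this limit exists for the functions
  \<open>g\<close> that are used.
\<close>

definition exponent_root :: "(real \<Rightarrow> real) \<Rightarrow> ereal \<Rightarrow> real" where
  "exponent_root g p =
     (if p = \<infinity> then Lim at_top (\<lambda>r. g r powr (1 / r))
      else g (real_of_ereal p) powr (1 / real_of_ereal p))"

lemma exponent_root_ereal [simp]: "exponent_root g (ereal r) = g r powr (1 / r)"
  by (simp add: exponent_root_def)

lemma exponent_root_infinity:
  assumes "((\<lambda>r. g r powr (1 / r)) \<longlongrightarrow> l) at_top"
  shows "exponent_root g \<infinity> = l"
  using assms by (simp add: exponent_root_def tendsto_Lim)

lemma exponent_root_infinity_midpoint: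
  "exponent_root (\<lambda>r. 1 / (r + 1)) \<infinity> = 1"
  by (rule exponent_root_infinity) real_asymp

lemma exponent_root_infinity_trapezoid:
  "exponent_root (\<lambda>r. (2 powr (r + 1) - 1) / (r + 1)) \<infinity> = 2"
  by (rule exponent_root_infinity) real_asymp

lemma exponent_root_infinity_simpson:
  "exponent_root (\<lambda>r. (2 powr (r + 1) - 1) / (3 * (r + 1))) \<infinity> = 2"
  by (rule exponent_root_infinity) real_asymp

end

theory Submission
  imports Defs "HOL-Analysis.Convex"
begin

text \<open>
  No integral identity is needed.  Convexity of \<open>t \<mapsto> t\<^sup>q\<close> gives
  \<open>(1 / (2 (q + 2)))\<^sup>1\<^sup>/\<^sup>q S \<ge> (1 / (q + 1))\<^sup>1\<^sup>/\<^sup>q (1 / a\<^sup>3 + 1 / b\<^sup>3)\<close>, and Young's inequality gives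
  \<open>(p + 1)\<^sup>1\<^sup>/\<^sup>p (q + 1)\<^sup>1\<^sup>/\<^sup>q \<le> (p + 1) / p + (q + 1) / q = 3\<close>.  With
  \<open>2\<^sup>p\<^sup>+\<^sup>1 - 1 \<ge> 2\<^sup>p\<close> and \<open>3\<^sup>1\<^sup>/\<^sup>p \<le> 3\<close> the right-hand sides are therefore at least
  \<open>1/24\<close>, \<open>1/12\<close> and \<open>1/108\<close> times \<open>(b - a)\<^sup>2 (1 / a\<^sup>3 + 1 / b\<^sup>3)\<close>, independently of \<open>p\<close> and \<open>q\<close>.
  After multiplication by \<open>b - a\<close> what remains are bounds for \<open>ln b - ln a\<close> with equality at
  \<open>b = a\<close>, and they follow from the sign of the derivative in \<open>b\<close>.
\<close>

section \<open>Quadrature bounds for the logarithm\<close>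

text \<open>The term \<open>2 * (b - a) / (a + b)\<close> is the midpoint rule for the integral of
  1/t over [a, b]. In the proof \<open>G x\<close> is its error on [a, x] and \<open>F x\<close> the
  slack in the upper bound; both vanish at \<open>a\<close> and are nondecreasing.\<close>

lemma ln_diff_midpoint:
  fixes a b :: real
  assumes "0 < a" "a \<le> b"
  shows "0 \<le> ln b - ln a - 2 * (b - a) / (a + b)"
    and "ln b - ln a - 2 * (b - a) / (a + b) \<le> (b - a) ^ 3 / 24 * (1 / a ^ 3 + 1 / b ^ 3)"
proof -
  define G where "G x = ln x - ln a - 2 * (x - a) / (a + x)" for x
  define F where "F x = (x - a) ^ 3 / 24 * (1 / a ^ 3 + 1 / x ^ 3) - G x" for x
  have G: "(G has_real_derivative (x - a)\<^sup>2 / (x * (a + x)\<^sup>2)) (at x)" if "0 < x" for x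
    unfolding G_def
    by (rule derivative_eq_intros refl | (use assms that in \<open>simp; fail\<close>))+
      (use assms that in \<open>simp add: divide_simps\<close>, algebra)
  have "G a \<le> G b"
  proof (rule DERIV_nonneg_imp_nondecreasing[OF assms(2)])
    fix x assume "a \<le> x" "x \<le> b"
    then have x: "0 < x" using assms by linarith
    show "\<exists>y. (G has_real_derivative y) (at x) \<and> 0 \<le> y"
      by (rule exI, rule conjI[OF G[OF x]]) (use assms x in simp)
  qed
  then show "0 \<le> ln b - ln a - 2 * (b - a) / (a + b)"
    by (simp add: G_def)
  have "F a \<le> F b"
  proof (rule DERIV_nonneg_imp_nondecreasing[OF assms(2)])
    fix x assume "a \<le> x" "x \<le> b"
    then have x: "0 < x" using assms by linarith
    have F: "(F has_real_derivative (x - a)\<^sup>2 * ((x ^ 4 + a ^ 4) * (a + x)\<^sup>2 - 8 * a ^ 3 * x ^ 3)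
        / (8 * a ^ 3 * x ^ 4 * (a + x)\<^sup>2)) (at x)"
      unfolding F_def
      by (rule derivative_eq_intros refl G[OF x] | (use assms x in \<open>simp; fail\<close>))+
        (use assms x in \<open>simp add: divide_simps\<close>, algebra)
    \<comment> \<open>The product of two AM-GM inequalities, for the pair \<open>x ^ 4\<close>,
      \<open>a ^ 4\<close> and for the pair \<open>a\<close>, \<open>x\<close>.\<close>
    have le: "8 * a ^ 3 * x ^ 3 \<le> (x ^ 4 + a ^ 4) * (a + x)\<^sup>2"
    proof -
      have "2 * (x * a)\<^sup>2 \<le> x ^ 4 + a ^ 4"
        using zero_le_power2[of "x\<^sup>2 - a\<^sup>2"] by (simp add: algebra_simps power2_eq_square power4_eq_xxxx)
      moreover have "4 * (x * a) \<le> (a + x)\<^sup>2"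
        using zero_le_power2[of "x - a"] by (simp add: algebra_simps power2_eq_square)
      ultimately have "(2 * (x * a)\<^sup>2) * (4 * (x * a)) \<le> (x ^ 4 + a ^ 4) * (a + x)\<^sup>2"
        using assms x by (intro mult_mono) auto
      then show ?thesis by (simp add: power2_eq_square power3_eq_cube mult_ac)
    qed
    show "\<exists>y. (F has_real_derivative y) (at x) \<and> 0 \<le> y"
      by (rule exI, rule conjI[OF F]) (use assms x le in simp)
  qed
  then show "ln b - ln a - 2 * (b - a) / (a + b) \<le> (b - a) ^ 3 / 24 * (1 / a ^ 3 + 1 / b ^ 3)"
    by (simp add: F_def G_def)
qed

text \<open>The same scheme for the trapezoid rule. The slack now has a derivative with a perfect
  square in it, since x^4 + a^4 - 2 a^2 x^2 = (x^2 - a^2)^2.\<close>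

lemma ln_diff_trapezoid:
  fixes a b :: real
  assumes "0 < a" "a \<le> b"
  shows "0 \<le> (b - a) * (a + b) / (2 * a * b) - (ln b - ln a)"
    and "(b - a) * (a + b) / (2 * a * b) - (ln b - ln a) \<le> (b - a) ^ 3 / 12 * (1 / a ^ 3 + 1 / b ^ 3)"
proof -
  define G where "G x = (x - a) * (a + x) / (2 * a * x) - (ln x - ln a)" for x
  define F where "F x = (x - a) ^ 3 / 12 * (1 / a ^ 3 + 1 / x ^ 3) - G x" for x
  have G: "(G has_real_derivative (x - a)\<^sup>2 / (2 * a * x\<^sup>2)) (at x)" if "0 < x" for x
    unfolding G_def
    by (rule derivative_eq_intros refl | (use assms that in \<open>simp; fail\<close>))+
      (use assms that in \<open>simp add: divide_simps\<close>, algebra)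
  have "G a \<le> G b"
  proof (rule DERIV_nonneg_imp_nondecreasing[OF assms(2)])
    fix x assume "a \<le> x" "x \<le> b"
    then have x: "0 < x" using assms by linarith
    show "\<exists>y. (G has_real_derivative y) (at x) \<and> 0 \<le> y"
      by (rule exI, rule conjI[OF G[OF x]]) (use assms x in simp)
  qed
  then show "0 \<le> (b - a) * (a + b) / (2 * a * b) - (ln b - ln a)"
    by (simp add: G_def)
  have "F a \<le> F b"
  proof (rule DERIV_nonneg_imp_nondecreasing[OF assms(2)])
    fix x assume "a \<le> x" "x \<le> b"
    then have x: "0 < x" using assms by linarith
    have F: "(F has_real_derivative (x - a)\<^sup>2 * (x\<^sup>2 - a\<^sup>2)\<^sup>2 / (4 * a ^ 3 * x ^ 4)) (at x)"
      unfolding F_def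
      by (rule derivative_eq_intros refl G[OF x] | (use assms x in \<open>simp; fail\<close>))+
        (use assms x in \<open>simp add: divide_simps\<close>, algebra)
    show "\<exists>y. (F has_real_derivative y) (at x) \<and> 0 \<le> y"
      by (rule exI, rule conjI[OF F]) (use assms x in simp)
  qed
  then show "(b - a) * (a + b) / (2 * a * b) - (ln b - ln a) \<le> (b - a) ^ 3 / 12 * (1 / a ^ 3 + 1 / b ^ 3)"
    by (simp add: F_def G_def)
qed

text \<open>Simpson's rule, that is, one third of the trapezoid rule plus two thirds of the midpoint
  rule. The term 1/a^3 alone suffices for the upper bound.\<close>

lemma ln_diff_simpson:
  fixes a b :: real
  assumes "0 < a" "a \<le> b"
  shows "0 \<le> (b - a) * (a + b) / (6 * a * b) + 4 * (b - a) / (3 * (a + b)) - (ln b - ln a)"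
    and "(b - a) * (a + b) / (6 * a * b) + 4 * (b - a) / (3 * (a + b)) - (ln b - ln a)
      \<le> (b - a) ^ 3 / (108 * a ^ 3)"
proof -
  define G where "G x = (x - a) * (a + x) / (6 * a * x) + 4 * (x - a) / (3 * (a + x)) - (ln x - ln a)" for x
  define F where "F x = (x - a) ^ 3 / (108 * a ^ 3) - G x" for x
  have G: "(G has_real_derivative (x - a) ^ 4 / (6 * a * x\<^sup>2 * (a + x)\<^sup>2)) (at x)" if "0 < x" for x
    unfolding G_def
    by (rule derivative_eq_intros refl | (use assms that in \<open>simp; fail\<close>))+
      (use assms that in \<open>simp add: divide_simps\<close>, algebra)
  have "G a \<le> G b"
  proof (rule DERIV_nonneg_imp_nondecreasing[OF assms(2)])
    fix x assume "a \<le> x" "x \<le> b"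
    then have x: "0 < x" using assms by linarith
    show "\<exists>y. (G has_real_derivative y) (at x) \<and> 0 \<le> y"
      by (rule exI, rule conjI[OF G[OF x]]) (use assms x in simp)
  qed
  then show "0 \<le> (b - a) * (a + b) / (6 * a * b) + 4 * (b - a) / (3 * (a + b)) - (ln b - ln a)"
    by (simp add: G_def)
  have "F a \<le> F b"
  proof (rule DERIV_nonneg_imp_nondecreasing[OF assms(2)])
    fix x assume xa: "a \<le> x" "x \<le> b"
    then have x: "0 < x" using assms by linarith
    have F: "(F has_real_derivative
        (x - a)\<^sup>2 * ((x * (a + x))\<^sup>2 - 6 * (a * (x - a))\<^sup>2) / (36 * a ^ 3 * x\<^sup>2 * (a + x)\<^sup>2)) (at x)"
      unfolding F_def
      by (rule derivative_eq_intros refl G[OF x] | (use assms x in \<open>simp; fail\<close>))+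
        (use assms x in \<open>simp add: divide_simps\<close>, algebra)
    \<comment> \<open>The factor 6 is raised to 9 = 3^2 so that a root can be taken; then x (a + x)
      - 3 a (x - a) = (x - a)^2 + 2 a^2.\<close>
    have le: "6 * (a * (x - a))\<^sup>2 \<le> (x * (a + x))\<^sup>2"
    proof -
      have "0 \<le> (x - a)\<^sup>2 + a * (2 * a)" using assms by simp
      then have "3 * (a * (x - a)) \<le> x * (a + x)"
        by (simp add: algebra_simps power2_eq_square)
      then have "(3 * (a * (x - a)))\<^sup>2 \<le> (x * (a + x))\<^sup>2"
        using assms xa by (intro power_mono) auto
      moreover have "6 * z\<^sup>2 \<le> (3 * z)\<^sup>2" for z :: real
        by (simp add: power_mult_distrib)
      ultimately show ?thesis by (rule order_trans[rotated])
    qed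
    show "\<exists>y. (F has_real_derivative y) (at x) \<and> 0 \<le> y"
      by (rule exI, rule conjI[OF F]) (use assms x le in simp)
  qed
  then show "(b - a) * (a + b) / (6 * a * b) + 4 * (b - a) / (3 * (a + b)) - (ln b - ln a)
      \<le> (b - a) ^ 3 / (108 * a ^ 3)"
    by (simp add: F_def G_def)
qed

section \<open>Lower bound for the sum of q-th roots\<close>

text \<open>Jensen's inequality for t^q with weights u/(u + v) and v/(u + v), followed by a q-th
  root. Leaving the weights unnormalised lets it apply directly to the weights 1 and
  \<open>c\<close> below.\<close>

lemma weighted_power_mean_ge:
  fixes q u v x y :: real
  assumes "1 \<le> q" "0 < u" "0 < v" "0 < x" "0 < y"
  shows "(u + v) powr (1 / q) * ((u * x + v * y) / (u + v)) \<le> (u * x powr q + v * y powr q) powr (1 / q)"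
proof -
  have "((u * x + v * y) / (u + v)) powr q \<le> (u * x powr q + v * y powr q) / (u + v)"
    using convex_onD[OF powr_convex[OF assms(1)], of "v / (u + v)" x y] assms
    by (simp add: divide_simps mult_ac)
  then have "(((u * x + v * y) / (u + v)) powr q) powr (1 / q)
      \<le> ((u * x powr q + v * y powr q) / (u + v)) powr (1 / q)"
    using assms by (intro powr_mono2) auto
  then show ?thesis
    using assms by (simp add: powr_powr powr_divide field_simps)
qed

lemma power_mean_sum_ge:
  fixes a b q :: real
  assumes "1 \<le> q" "0 < a" "0 < b"
  defines "c \<equiv> (q + 3) / (q + 1)"
  shows "(1 / (q + 1)) powr (1 / q) * (1 / a ^ 3 + 1 / b ^ 3) \<le> (1 / (2 * (q + 2))) powr (1 / q) *
    ((1 / b powr (3 * q) + c / a powr (3 * q)) powr (1 / q)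
      + (c / b powr (3 * q) + 1 / a powr (3 * q)) powr (1 / q))"
proof -
  \<comment> \<open>The total weight is 1 + c = 2 (q + 2) / (q + 1), which turns the factor 1/(2 (q
    + 2)) into 1/(q + 1).\<close>
  have c: "0 < c" "(1 / (q + 1)) powr (1 / q) = (1 / (2 * (q + 2))) powr (1 / q) * (1 + c) powr (1 / q)"
    using assms(1) by (auto simp: c_def powr_mult[symmetric] divide_simps)
  have cube: "(1 / x ^ 3) powr q = 1 / x powr (3 * q)" if "0 < x" for x :: real
    using that by (simp add: powr_divide powr_powr flip: powr_numeral)
  have 1: "(1 + c) powr (1 / q) * ((1 / b ^ 3 + c / a ^ 3) / (1 + c))
      \<le> (1 / b powr (3 * q) + c / a powr (3 * q)) powr (1 / q)"
    using weighted_power_mean_ge[of q 1 c "1 / b ^ 3" "1 / a ^ 3"] assms(1-3) c(1)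
    by (simp add: cube)
  have 2: "(1 + c) powr (1 / q) * ((c / b ^ 3 + 1 / a ^ 3) / (1 + c))
      \<le> (c / b powr (3 * q) + 1 / a powr (3 * q)) powr (1 / q)"
    using weighted_power_mean_ge[of q c 1 "1 / b ^ 3" "1 / a ^ 3"] assms(1-3) c(1)
    by (simp add: cube add.commute)
  \<comment> \<open>The two summands carry the weights 1 and \<open>c\<close> in opposite order, so
    the weighted means add up to a sum free of \<open>c\<close>.\<close>
  have eq: "(1 / b ^ 3 + c / a ^ 3) / (1 + c) + (c / b ^ 3 + 1 / a ^ 3) / (1 + c) = 1 / a ^ 3 + 1 / b ^ 3"
    using c(1) assms(2,3) by (simp add: divide_simps) algebra
  have "(1 + c) powr (1 / q) * (1 / a ^ 3 + 1 / b ^ 3)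
      = (1 + c) powr (1 / q) * ((1 / b ^ 3 + c / a ^ 3) / (1 + c))
        + (1 + c) powr (1 / q) * ((c / b ^ 3 + 1 / a ^ 3) / (1 + c))"
    unfolding eq[symmetric] by (rule distrib_left)
  also note add_mono[OF 1 2]
  finally have "(1 + c) powr (1 / q) * (1 / a ^ 3 + 1 / b ^ 3)
      \<le> (1 / b powr (3 * q) + c / a powr (3 * q)) powr (1 / q)
        + (c / b powr (3 * q) + 1 / a powr (3 * q)) powr (1 / q)" .
  then show ?thesis
    unfolding c(2) mult.assoc by (intro mult_left_mono) auto
qed

section \<open>Conjugate exponents and their roots\<close>

text \<open>Since 1/q is at most 1, a finite \<open>p\<close> has 1/p nonnegative. In
  \<open>ereal\<close>, 1/0 is infinite, which rules out p = 0, and 1/p vanishes at both infinities,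
  which forces q = 1 there.\<close>

lemma ereal_conjugate_exponent_cases:
  fixes p :: ereal and q :: real
  assumes "p \<noteq> -\<infinity>" "1 \<le> q" "1 / p + 1 / ereal q = 1"
  obtains "p = \<infinity>" "q = 1" | r where "p = ereal r" "0 < r" "1 / r + 1 / q = 1"
proof (cases p)
  case (real r)
  show ?thesis
  proof (cases "r = 0")
    case True
    then show ?thesis using assms real by (simp add: one_ereal_def)
  next
    case False
    then have e: "1 / r + 1 / q = 1"
      using assms real by (simp add: one_ereal_def)
    have "1 / q \<le> 1" using assms by simp
    then have "0 \<le> 1 / r" using e by linarith
    then show ?thesis using that(2)[OF real _ e] False by simp
  qed
next
  case PInf
  then show ?thesis using assms that(1) by (simp add: one_ereal_def)
next
  case MInf
  then show ?thesis using assms by simp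
qed

text \<open>Young's inequality with weights 1/r and 1/q gives the first bound; the other two follow
  by extracting the factors 2 and 1/3. Divided by 8, 8 and 24, the constants become the 1/24, 1/12
  and 1/108 of the logarithm bounds.\<close>

lemma conjugate_exponent_roots_ge:
  fixes r q :: real
  assumes "0 < r" "1 \<le> q" "1 / r + 1 / q = 1"
  shows "1 / 3 \<le> (1 / (r + 1)) powr (1 / r) * (1 / (q + 1)) powr (1 / q)"
    and "2 / 3 \<le> ((2 powr (r + 1) - 1) / (r + 1)) powr (1 / r) * (1 / (q + 1)) powr (1 / q)"
    and "2 / 9 \<le> ((2 powr (r + 1) - 1) / (3 * (r + 1))) powr (1 / r) * (1 / (q + 1)) powr (1 / q)"
proof -
  let ?m = "(1 / (r + 1)) powr (1 / r) * (1 / (q + 1)) powr (1 / q)"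
  have "(r + 1) powr (1 / r) * (q + 1) powr (1 / q) \<le> 1 / r * (r + 1) + 1 / q * (q + 1)"
    using assms by (intro Youngs_inequality_0) auto
  also have "\<dots> = 2 + (1 / r + 1 / q)"
    using assms(1,2) by (simp add: field_simps)
  finally have "(r + 1) powr (1 / r) * (q + 1) powr (1 / q) \<le> 3"
    using assms(3) by simp
  then have "1 / 3 \<le> 1 / ((r + 1) powr (1 / r) * (q + 1) powr (1 / q))"
    using assms by (intro divide_left_mono) auto
  then show mid: "1 / 3 \<le> ?m"
    using assms by (simp add: powr_divide)
  have "1 \<le> (2::real) powr r"
    using assms by (intro ge_one_powr_ge_zero) auto
  then have ge: "2 powr r \<le> 2 powr (r + 1) - (1::real)"
    by (simp add: powr_add)
  then have pos: "0 < 2 powr (r + 1) - (1::real)"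
    by (smt (verit) powr_gt_zero)
  have "(2 powr r) powr (1 / r) \<le> (2 powr (r + 1) - 1 :: real) powr (1 / r)"
    using assms ge by (intro powr_mono2) auto
  then have two: "2 \<le> (2 powr (r + 1) - 1 :: real) powr (1 / r)"
    using assms(1) by (simp add: powr_powr)
  have "2 * (1 / 3) \<le> (2 powr (r + 1) - 1) powr (1 / r) * ?m"
    using two mid by (intro mult_mono) auto
  also have "\<dots> = ((2 powr (r + 1) - 1) / (r + 1)) powr (1 / r) * (1 / (q + 1)) powr (1 / q)"
    using assms pos by (simp add: powr_divide)
  finally show trap: "2 / 3 \<le> ((2 powr (r + 1) - 1) / (r + 1)) powr (1 / r) * (1 / (q + 1)) powr (1 / q)"
    by simp
  have "1 / r \<le> 1" using assms by (smt (verit) divide_nonneg_nonneg)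
  then have "(3::real) powr (1 / r) \<le> 3 powr 1"
    by (intro powr_mono) auto
  then have "1 / 3 \<le> 1 / (3::real) powr (1 / r)"
    by (intro divide_left_mono) auto
  then have "1 / 3 \<le> (1 / 3 :: real) powr (1 / r)"
    by (simp add: powr_divide)
  then have "1 / 3 * (2 / 3) \<le> (1 / 3) powr (1 / r) *
      (((2 powr (r + 1) - 1) / (r + 1)) powr (1 / r) * (1 / (q + 1)) powr (1 / q))"
    using trap by (intro mult_mono) auto
  also have "\<dots> = ((2 powr (r + 1) - 1) / (3 * (r + 1))) powr (1 / r) * (1 / (q + 1)) powr (1 / q)"
    unfolding mult.assoc[symmetric] using assms pos by (simp flip: powr_mult)
  finally show "2 / 9 \<le> ((2 powr (r + 1) - 1) / (3 * (r + 1))) powr (1 / r) * (1 / (q + 1)) powr (1 / q)"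
    by simp
qed

lemma exponent_roots_ge:
  fixes p :: ereal and q :: real
  assumes "p \<noteq> -\<infinity>" "1 \<le> q" "1 / p + 1 / ereal q = 1"
  shows "1 / 3 \<le> exponent_root (\<lambda>r. 1 / (r + 1)) p * (1 / (q + 1)) powr (1 / q)" (is ?A)
    and "2 / 3 \<le> exponent_root (\<lambda>r. (2 powr (r + 1) - 1) / (r + 1)) p * (1 / (q + 1)) powr (1 / q)" (is ?B)
    and "2 / 9 \<le> exponent_root (\<lambda>r. (2 powr (r + 1) - 1) / (3 * (r + 1))) p * (1 / (q + 1)) powr (1 / q)" (is ?C)
proof -
  have "?A \<and> ?B \<and> ?C"
    using assms
  proof (cases rule: ereal_conjugate_exponent_cases)
    \<comment> \<open>The limits 1, 2, 2 are multiplied by (1/2)^1, which leaves 1/2, 1, 1.\<close>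
    case 1
    show ?thesis
      unfolding 1 exponent_root_infinity_midpoint exponent_root_infinity_trapezoid
        exponent_root_infinity_simpson by simp
  next
    case (2 r)
    show ?thesis
      unfolding 2(1) exponent_root_ereal
      using conjugate_exponent_roots_ge[OF 2(2) assms(2) 2(3)] by blast
  qed
  then show ?A ?B ?C by blast+
qed

theorem proposition4:
  fixes a b q S :: real and p :: ereal
  assumes "0 < a" and "a < b"
    and "1 \<le> q" and "p \<noteq> -\<infinity>" and "1 / p + 1 / ereal q = 1"
    and "S = (\<Sum>i::nat = 1..2.
               (((q + 3) / (q + 1)) ^ (i - 1) * (1 / b powr (3 * q))
                + ((q + 3) / (q + 1)) ^ (2 - i) * (1 / a powr (3 * q))) powr (1 / q))"
  shows "\<bar>1 / arith_mean a b - 1 / log_mean a b\<bar>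
           \<le> (b - a)\<^sup>2 / 8 * exponent_root (\<lambda>r. 1 / (r + 1)) p
              * (1 / (2 * (q + 2))) powr (1 / q) * S
       \<and> \<bar>1 / harm_mean a b - 1 / log_mean a b\<bar>
           \<le> (b - a)\<^sup>2 / 8 * exponent_root (\<lambda>r. (2 powr (r + 1) - 1) / (r + 1)) p
              * (1 / (2 * (q + 2))) powr (1 / q) * S
       \<and> \<bar>1 / 3 * (1 / harm_mean a b) + 2 / 3 * (1 / arith_mean a b) - 1 / log_mean a b\<bar>
           \<le> (b - a)\<^sup>2 / 24 * exponent_root (\<lambda>r. (2 powr (r + 1) - 1) / (3 * (r + 1))) p
              * (1 / (2 * (q + 2))) powr (1 / q) * S"
proof -
  define T where "T = 1 / a ^ 3 + 1 / b ^ 3"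
  have T: "0 \<le> T" "1 / a ^ 3 \<le> T" using assms(1,2) by (auto simp: T_def)
  \<comment> \<open>For these two indices the natural subtractions in the exponents never
    truncate.\<close>
  have "{1..2::nat} = {1, 2}" by auto
  then have S: "(1 / (q + 1)) powr (1 / q) * T \<le> (1 / (2 * (q + 2))) powr (1 / q) * S"
    using power_mean_sum_ge[of q a b] assms(1-3) by (simp add: assms(6) T_def)
  \<comment> \<open>Shared by all three estimates: \<open>x\<close> is the distance of the means,
    \<open>E\<close> the root in \<open>p\<close>, \<open>d\<close> the denominator 8 or 24, and
    \<open>k\<close> the lower bound 1/3, 2/3 or 2/9.\<close>
  have bound: "x \<le> (b - a)\<^sup>2 / d * E * (1 / (2 * (q + 2))) powr (1 / q) * S"
    if x: "x * (b - a) \<le> (b - a) ^ 3 * (k / d * T)"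
      and E: "k \<le> E * (1 / (q + 1)) powr (1 / q)" and "0 < k" "0 < d" for x d k E
  proof -
    have "0 < E * (1 / (q + 1)) powr (1 / q)" using E \<open>0 < k\<close> by linarith
    then have "0 \<le> E" by (simp add: zero_less_mult_iff)
    have "x \<le> (b - a)\<^sup>2 * (k / d * T)"
    proof (rule mult_right_le_imp_le)
      show "x * (b - a) \<le> (b - a)\<^sup>2 * (k / d * T) * (b - a)"
        using x by (simp add: power3_eq_cube power2_eq_square mult_ac)
      show "0 < b - a" using assms(2) by simp
    qed
    also have "\<dots> = (b - a)\<^sup>2 / d * (k * T)" by simp
    also have "k * T \<le> E * ((1 / (q + 1)) powr (1 / q) * T)"
      using mult_right_mono[OF E T(1)] by (simp add: mult.assoc)
    also have "\<dots> \<le> E * ((1 / (2 * (q + 2))) powr (1 / q) * S)"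
      using S \<open>0 \<le> E\<close> by (rule mult_left_mono)
    finally show ?thesis
      using \<open>0 < d\<close> by (simp add: mult.assoc mult_left_mono divide_right_mono)
  qed
  note ab = assms(1) less_imp_le[OF assms(2)]
  \<comment> \<open>Multiplied by \<open>b - a\<close>, the reciprocals of the logarithmic,
    arithmetic and harmonic means become the integral of 1/t, its midpoint rule and its trapezoid
    rule.\<close>
  have L: "1 / log_mean a b * (b - a) = ln b - ln a"
    using assms(1,2) by (simp add: log_mean_def)
  have A: "1 / arith_mean a b * (b - a) = 2 * (b - a) / (a + b)"
    by (simp add: arith_mean_def)
  have H: "1 / harm_mean a b * (b - a) = (b - a) * (a + b) / (2 * a * b)"
    by (simp add: harm_mean_def)
  have abs: "\<bar>z\<bar> * (b - a) = \<bar>z * (b - a)\<bar>" for z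
    using assms(2) by (simp add: abs_mult)
  have mid: "(1 / arith_mean a b - 1 / log_mean a b) * (b - a)
      = - (ln b - ln a - 2 * (b - a) / (a + b))"
    unfolding left_diff_distrib A L by simp
  have trap: "(1 / harm_mean a b - 1 / log_mean a b) * (b - a)
      = (b - a) * (a + b) / (2 * a * b) - (ln b - ln a)"
    unfolding left_diff_distrib H L ..
  have "(1 / 3 * (1 / harm_mean a b) + 2 / 3 * (1 / arith_mean a b) - 1 / log_mean a b) * (b - a)
      = 1 / 3 * (1 / harm_mean a b * (b - a)) + 2 / 3 * (1 / arith_mean a b * (b - a))
        - 1 / log_mean a b * (b - a)"
    by (simp only: left_diff_distrib distrib_right mult.assoc)
  also have "\<dots> = (b - a) * (a + b) / (6 * a * b) + 4 * (b - a) / (3 * (a + b)) - (ln b - ln a)"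
    unfolding A H L by simp
  finally have simpson: "(1 / 3 * (1 / harm_mean a b) + 2 / 3 * (1 / arith_mean a b) - 1 / log_mean a b) * (b - a)
      = (b - a) * (a + b) / (6 * a * b) + 4 * (b - a) / (3 * (a + b)) - (ln b - ln a)" .
  have "(b - a) ^ 3 / (108 * a ^ 3) = (b - a) ^ 3 / 108 * (1 / a ^ 3)" by simp
  also have "\<dots> \<le> (b - a) ^ 3 / 108 * T"
    using T(2) ab by (intro mult_left_mono) auto
  finally have T_simpson: "(b - a) ^ 3 / (108 * a ^ 3) \<le> (b - a) ^ 3 / 108 * T" .
  have "\<bar>1 / arith_mean a b - 1 / log_mean a b\<bar> * (b - a) \<le> (b - a) ^ 3 * (1 / 3 / 8 * T)"
    unfolding abs mid abs_minus_cancel using ln_diff_midpoint[OF ab] by (simp add: T_def)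
  moreover have "\<bar>1 / harm_mean a b - 1 / log_mean a b\<bar> * (b - a) \<le> (b - a) ^ 3 * (2 / 3 / 8 * T)"
    unfolding abs trap using ln_diff_trapezoid[OF ab] by (simp add: T_def)
  moreover have "\<bar>1 / 3 * (1 / harm_mean a b) + 2 / 3 * (1 / arith_mean a b) - 1 / log_mean a b\<bar> * (b - a)
      \<le> (b - a) ^ 3 * (2 / 9 / 24 * T)"
    unfolding abs simpson using ln_diff_simpson[OF ab] T_simpson by linarith
  ultimately show ?thesis
    using exponent_roots_ge[OF assms(4,3,5)] by (intro conjI; intro bound) (assumption | simp)+
qed

end
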